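(* Let $P$ be given by $\frac1{P(z)}=\sum_{n=1}^\infty a_nq^n$, $q=e(z)=e^{2\pi iz}$, $\operatorname{Im}(z)>0$, with $a_1\neq0$, and put $$w(q)=2\pi i\int_{i\infty}^{z}\frac{dt}{P(t)},\qquad q=e(z).$$ Let $y$, $G$ be analytic functions and $c$ a constant such that $$5\int_0^{y(A)}\frac{G(t)}{t\sqrt[6]{t^{-5}-11-t^5}}\,dt=A,\qquad 5\int_0^{y(A)}\frac{dt}{t\sqrt[6]{t^{-5}-11-t^5}}=\frac{c-w(e(A))}{2\pi i}.$$ Then $w$ is the solution of $$\frac{w(q)}{f(w(q))}=q,$$ where $f$ is given (with a suitable multiplicative constant of integration) by $$\frac{f'(A)}{f(A)}=\frac1A+G\Bigl(F_1\Bigl(-\frac{A}{2\pi i}+\frac{c}{2\pi i}\Bigr)\Bigr),$$ and moreover $$y(A)=F_1\Bigl(-\frac{w(q_A)}{2\pi i}+\frac{c}{2\pi i}\Bigr),\qquad q_A=e(A).$$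
   Context: $F_1$ denotes the (local) inverse of $x\mapsto 5\int_0^x \frac{dt}{t\sqrt[6]{t^{-5}-11-t^5}}$, so $F_1'(A)=\frac15F_1(A)\sqrt[6]{F_1(A)^{-5}-11-F_1(A)^5}$. The series $\sum a_nq^n$ has positive radius of convergence, and $w(q)=\sum_{n\ge1}\frac{a_n}{n}q^n$. All identities are understood on regions where the functions involved are analytic, with consistent local branches of inverses and of the sixth root. *)

theory Defs
  imports "HOL-Complex_Analysis.Complex_Analysis"
begin

definition qe :: "complex \<Rightarrow> complex" where
  "qe z = exp (2 * of_real pi * \<i> * z)"

definition sixth_root_on :: "complex set \<Rightarrow> (complex \<Rightarrow> complex) \<Rightarrow> bool" where
  "sixth_root_on U r \<longleftrightarrow>
     r holomorphic_on U \<and> (\<forall>t\<in>U. r t ^ 6 = inverse (t ^ 5) - 11 - t ^ 5)"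

text \<open>
  \<open>has_quintic_integral r \<phi> g I\<close> says that 5 times the integral of \<open>\<phi> t / (t * r t)\<close> along \<open>g\<close>
  exists and equals \<open>I\<close>. Here \<open>g\<close> starts at the singular point 0; contour integrals are
  Henstock-Kurzweil integrals in the path parameter, so that convergent improper integrals
  at the endpoint are included and the (arbitrary) value of the integrand at 0 does not matter.
\<close>
definition has_quintic_integral ::
    "(complex \<Rightarrow> complex) \<Rightarrow> (complex \<Rightarrow> complex) \<Rightarrow> (real \<Rightarrow> complex) \<Rightarrow> complex \<Rightarrow> bool" where
  "has_quintic_integral r \<phi> g I \<longleftrightarrow>
     (\<lambda>t. \<phi> t / (t * r t)) contour_integrable_on g \<and>
     5 * contour_integral g (\<lambda>t. \<phi> t / (t * r t)) = I"

text \<open>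
  A branch of the integral from 0 to \<open>x\<close> is fixed by an initial path \<open>\<gamma>\<close> leaving 0 inside the
  region \<open>U\<close> where the integrand is analytic; it is then continued along paths beginning at
  the end point of \<open>\<gamma>\<close>.
\<close>
definition initial_path :: "complex set \<Rightarrow> (real \<Rightarrow> complex) \<Rightarrow> bool" where
  "initial_path U \<gamma> \<longleftrightarrow> valid_path \<gamma> \<and> pathstart \<gamma> = 0 \<and> \<gamma> ` {0<..1} \<subseteq> U"

text \<open>
  \<open>F\<close> is the inverse, for \<open>x\<close> in the region \<open>Y\<close>, of the function sending \<open>x\<close> to 5 times the
  integral of \<open>1 / (t * r t)\<close> from 0 to \<open>x\<close>. Nothing is required of \<open>F\<close> at points that are
  not values of this integral.
\<close>
definition inverse_branch ::
    "(complex \<Rightarrow> complex) \<Rightarrow> (real \<Rightarrow> complex) \<Rightarrow> complex set \<Rightarrow> (complex \<Rightarrow> complex) \<Rightarrow> bool" where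
  "inverse_branch r \<gamma> Y F \<longleftrightarrow>
     (\<forall>x\<in>Y. \<forall>p s. valid_path p \<and> path_image p \<subseteq> Y \<and> pathstart p = pathfinish \<gamma> \<and> pathfinish p = x \<and>
        has_quintic_integral r (\<lambda>t. 1) (\<gamma> +++ p) s \<longrightarrow> F s = x)"

text \<open>
  A family of paths in \<open>Y\<close> from \<open>b\<close> to \<open>y A\<close>, varying continuously with \<open>A\<close>: integrals
  along its members are branches depending consistently on \<open>A\<close>, even when the region \<open>Y\<close> is
  not simply connected.
\<close>
definition path_family ::
    "complex set \<Rightarrow> complex set \<Rightarrow> complex \<Rightarrow> (complex \<Rightarrow> complex) \<Rightarrow> (complex \<Rightarrow> real \<Rightarrow> complex) \<Rightarrow> bool"
  where
  "path_family D Y b y p \<longleftrightarrow>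
     continuous_on (D \<times> {0..1}) (\<lambda>(A, s). p A s) \<and>
     (\<forall>A\<in>D. valid_path (p A) \<and> path_image (p A) \<subseteq> Y \<and> pathstart (p A) = b \<and> pathfinish (p A) = y A)"

definition f_equation ::
    "(complex \<Rightarrow> complex) \<Rightarrow> (complex \<Rightarrow> complex) \<Rightarrow> complex \<Rightarrow> (complex \<Rightarrow> complex) \<Rightarrow> complex \<Rightarrow> bool" where
  "f_equation G F c f A \<longleftrightarrow>
     deriv f A / f A =
       1 / A + G (F (- (A / (2 * of_real pi * \<i>)) + c / (2 * of_real pi * \<i>)))"

end

theory Submission
  imports Defs
begin

text \<open>
  The function \<open>w\<close> is the power series \<open>h(q) = \<Sum> a\<^sub>n q\<^sup>n / n\<close>, since \<open>h(e(z))\<close> is a primitive of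
  \<open>2\<pi>i / P\<close> vanishing at the cusp. Differentiating both integral equations in \<open>A\<close>, where only the
  end point of the path contributes, and dividing gives \<open>G(y(A)) = -1 / (q h'(q))\<close> for \<open>q = e(A)\<close>,
  while the second equation says \<open>y(A) = F\<^sub>1((c - w(q)) / 2\<pi>i)\<close>. The equation for \<open>f\<close> at
  \<open>x = h(q)\<close> thus reads \<open>f'(x)/f(x) = 1/x - 1/(q h'(q))\<close>: the logarithmic derivative of
  \<open>x / f(x)\<close> is that of the local inverse of \<open>h\<close>.
\<close>

section \<open>Nonvanishing of the sixth root\<close>

text \<open>At a zero of \<open>r\<close> the sixth power is stationary, so
  \<open>inverse (t ^ 5) - 11 - t ^ 5\<close> would vanish together with its derivative. In
  \<open>x = t ^ 5\<close> this means \<open>x ^ 2 + 11 * x - 1 = 0\<close> and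
  \<open>x ^ 2 = -1\<close>, which are incompatible.\<close>

lemma sixth_root_nonzero:
  assumes "open U" "0 \<notin> U" "sixth_root_on U r" "t \<in> U"
  shows "r t \<noteq> 0"
proof
  assume r0: "r t = 0"
  have t0: "t \<noteq> 0" using assms by auto
  have eq: "r s ^ 6 = inverse (s ^ 5) - 11 - s ^ 5" if "s \<in> U" for s
    using assms(3) that by (auto simp: sixth_root_on_def)
  have "r field_differentiable at t"
    using assms by (auto simp: sixth_root_on_def intro: holomorphic_on_imp_differentiable_at)
  then obtain r' where r': "(r has_field_derivative r') (at t)"
    by (auto simp: field_differentiable_def)
  have "((\<lambda>s. r s ^ 6) has_field_derivative 0) (at t)"
    by (rule derivative_eq_intros r' refl | simp add: r0)+
  then have d1: "((\<lambda>s. inverse (s ^ 5) - 11 - s ^ 5) has_field_derivative 0) (at t)"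
    by (rule has_field_derivative_transform_within_open[OF _ assms(1) assms(4)]) (use eq in auto)
  have d2: "((\<lambda>s. inverse (s ^ 5) - 11 - s ^ 5) has_field_derivative
      - (inverse (t ^ 5) * (5 * t ^ 4) * inverse (t ^ 5)) - 5 * t ^ 4) (at t)"
    by (auto intro!: derivative_eq_intros simp: t0)
  define x where "x = t ^ 5"
  have x0: "x \<noteq> 0" using t0 by (simp add: x_def)
  have "- (inverse x * (5 * t ^ 4) * inverse x) - 5 * t ^ 4 = 0"
    using DERIV_unique[OF d1 d2] by (simp add: x_def)
  moreover have "inverse x * x = 1" using x0 by simp
  ultimately have "5 * t ^ 4 * (1 + x ^ 2) = 0" by algebra
  then have x2: "x ^ 2 = -1"
    using t0 by (simp add: add_eq_0_iff)
  have "inverse x - 11 - x = 0"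
    using eq[OF assms(4)] r0 by (simp add: x_def)
  moreover have "inverse x * x = 1" using x0 by simp
  ultimately have "11 * x = 2" using x2 by algebra
  then have "(11 * x) ^ 2 = 2 ^ 2" by simp
  then have "121 * x ^ 2 = 4" by (simp add: power_mult_distrib)
  with x2 show False by simp
qed

section \<open>Differentiation of integrals with a moving end point\<close>

text \<open>\<open>Y\<close> may fail to be simply connected, so \<open>g\<close> need not have a
  global primitive. A primitive \<open>\<Phi>\<close> on a disc about \<open>y A0\<close> suffices:
  paths for nearby parameters are close, so by Cauchy's theorem their integrals differ only by the
  increment of \<open>\<Phi>\<close> between the end points.\<close>

lemma has_field_derivative_contour_integral_path_family:
  assumes Y: "open Y" and g: "g holomorphic_on Y"
    and D: "open D" "A0 \<in> D"
    and y: "(y has_field_derivative y') (at A0)"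
    and fam: "path_family D Y b y p"
  shows "((\<lambda>A. contour_integral (p A) g) has_field_derivative g (y A0) * y') (at A0)"
proof -
  have pA: "valid_path (p A)" "path_image (p A) \<subseteq> Y" "pathstart (p A) = b" "pathfinish (p A) = y A"
    if "A \<in> D" for A using fam that by (auto simp: path_family_def)
  have cont: "continuous_on (D \<times> {0..1}) (\<lambda>(A, s). p A s)"
    using fam by (simp add: path_family_def)
  have p1: "p A 1 = y A" if "A \<in> D" for A
    using pA(4)[OF that] by (simp add: pathfinish_def)
  have yY: "y A0 \<in> Y" using pA(2,4)[OF D(2)] by (metis pathfinish_in_path_image subsetD)
  obtain \<epsilon> where \<epsilon>: "0 < \<epsilon>" "ball (y A0) \<epsilon> \<subseteq> Y"
    using Y yY openE by blast
  obtain \<Phi> where "\<And>x. x \<in> ball (y A0) \<epsilon> \<Longrightarrow> (\<Phi> has_field_derivative g x) (at x within ball (y A0) \<epsilon>)"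
    using holomorphic_convex_primitive'[OF convex_ball open_ball holomorphic_on_subset[OF g \<epsilon>(2)]]
    by metis
  then have \<Phi>: "(\<Phi> has_field_derivative g x) (at x)" if "x \<in> ball (y A0) \<epsilon>" for x
    using that by (metis at_within_open open_ball)
  \<comment> \<open>closing up all members of the family at the same end point \<open>y A0\<close> makes them comparable
    by the homotopy form of Cauchy's theorem\<close>
  define Q where "Q A = p A +++ linepath (y A) (y A0)" for A
  have "path (Q A0)" "path_image (Q A0) \<subseteq> Y"
    using pA[OF D(2)] yY by (auto simp: Q_def path_image_join valid_path_imp_path)
  from contour_integral_nearby_ends[OF Y this] obtain d where d: "0 < d"
    and near: "\<And>g h f. \<lbrakk>valid_path g; valid_path h;
       \<forall>t\<in>{0..1}. norm (g t - Q A0 t) < d \<and> norm (h t - Q A0 t) < d;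
       pathstart h = pathstart g; pathfinish h = pathfinish g; f holomorphic_on Y\<rbrakk>
       \<Longrightarrow> contour_integral h f = contour_integral g f"
    by metis
  obtain e where e: "0 < e" "cball A0 e \<subseteq> D"
    using D open_contains_cball by blast
  \<comment> \<open>Compactness turns joint continuity into closeness of whole paths. The tolerance
    \<open>d\<close> serves Cauchy's theorem, and \<open>\<epsilon>\<close> keeps \<open>y A\<close>
    in the disc of \<open>\<Phi>\<close>.\<close>
  have "uniformly_continuous_on (cball A0 e \<times> {0..1}) (\<lambda>(A, s). p A s)"
    using e by (intro compact_uniformly_continuous continuous_on_subset[OF cont] compact_Times) auto
  moreover have "0 < min d \<epsilon>" using d \<epsilon> by simp
  ultimately obtain \<delta> where \<delta>: "0 < \<delta>"
    and unif: "\<And>u v. \<lbrakk>u \<in> cball A0 e \<times> {0..1}; v \<in> cball A0 e \<times> {0..1}; dist v u < \<delta>\<rbrakk>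
       \<Longrightarrow> dist ((\<lambda>(A, s). p A s) v) ((\<lambda>(A, s). p A s) u) < min d \<epsilon>"
    unfolding uniformly_continuous_on_def by metis
  define \<eta> where "\<eta> = min e \<delta>"
  have \<eta>: "0 < \<eta>" using e \<delta> by (simp add: \<eta>_def)
  have AD: "A \<in> D" if "A \<in> ball A0 \<eta>" for A
    using that e by (auto simp: \<eta>_def)
  have close: "norm (p A s - p A0 s) < min d \<epsilon>" if "A \<in> ball A0 \<eta>" "s \<in> {0..1}" for A s
    using unif[of "(A0, s)" "(A, s)"] that e
    by (auto simp: \<eta>_def dist_norm dist_Pair_Pair norm_minus_commute)
  have yclose: "norm (y A - y A0) < min d \<epsilon>" if "A \<in> ball A0 \<eta>" for A
    using close[OF that, of 1] p1[OF AD[OF that]] p1[OF D(2)] by simp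
  have int: "contour_integral (p A) g = contour_integral (p A0) g + (\<Phi> (y A) - \<Phi> (y A0))"
    if A: "A \<in> ball A0 \<eta>" for A
  proof -
    have yA: "y A \<in> ball (y A0) \<epsilon>" using yclose[OF A] by (simp add: dist_norm norm_minus_commute)
    have Qint: "contour_integral (Q B) g = contour_integral (p B) g + (\<Phi> (y A0) - \<Phi> (y B))"
      if B: "B \<in> D" "y B \<in> ball (y A0) \<epsilon>" for B
    proof -
      have "closed_segment (y B) (y A0) \<subseteq> ball (y A0) \<epsilon>"
        using B \<epsilon> by (intro closed_segment_subset) auto
      then have L: "(g has_contour_integral (\<Phi> (y A0) - \<Phi> (y B))) (linepath (y B) (y A0))"
        using contour_integral_primitive[of "ball (y A0) \<epsilon>" \<Phi> g "linepath (y B) (y A0)"] \<Phi>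
        by (auto intro: has_field_derivative_at_within)
      have "g contour_integrable_on p B"
        by (rule contour_integrable_holomorphic_simple[OF g Y pA(1,2)[OF B(1)]])
      with L show ?thesis unfolding Q_def
        using pA[OF B(1)] contour_integral_unique[OF L] has_contour_integral_integrable[OF L] by simp
    qed
    have "norm (Q A t - Q A0 t) < d" if t: "t \<in> {0..1}" for t
    proof (cases "t \<le> 1/2")
      case True
      then show ?thesis using close[OF A, of "2 * t"] t by (auto simp: Q_def joinpaths_def)
    next
      case False
      \<comment> \<open>Both closing segments end at \<open>y A0\<close>, so only their starting
        points contribute, with a factor in \<open>[0, 1]\<close>.\<close>
      have "Q A t - Q A0 t = of_real (2 - 2 * t) * (y A - y A0)"
        using False by (simp add: Q_def joinpaths_def linepath_def scaleR_conv_of_real algebra_simps)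
      then have "norm (Q A t - Q A0 t) = (2 - 2 * t) * norm (y A - y A0)"
        using t by (simp only: norm_mult norm_of_real) auto
      also have "\<dots> \<le> 1 * norm (y A - y A0)"
        using False by (intro mult_right_mono) auto
      also have "\<dots> < d" using yclose[OF A] by simp
      finally show ?thesis .
    qed
    then have "contour_integral (Q A) g = contour_integral (Q A0) g"
      using pA[OF D(2)] pA[OF AD[OF A]] d
      by (intro near g) (auto simp: Q_def valid_path_join)
    then show ?thesis
      using Qint[OF AD[OF A] yA] Qint[OF D(2)] \<epsilon> by (simp add: algebra_simps)
  qed
  have \<Phi>y: "((\<lambda>A. \<Phi> (y A)) has_field_derivative g (y A0) * y') (at A0)"
    by (rule DERIV_chain2[OF \<Phi> y]) (simp add: \<epsilon>)
  have "((\<lambda>A. contour_integral (p A0) g + (\<Phi> (y A) - \<Phi> (y A0))) has_field_derivative g (y A0) * y') (at A0)"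
    using DERIV_add[OF DERIV_const DERIV_diff[OF \<Phi>y DERIV_const]] by simp
  then show ?thesis
    by (rule has_field_derivative_transform_within_open[OF _ open_ball[of A0 \<eta>]])
       (simp add: \<eta>, rule int[symmetric])
qed

text \<open>The improper part along \<open>\<gamma>\<close> does not depend on \<open>A\<close> and
  drops out. On \<open>Y\<close> the integrand is holomorphic, because neither \<open>t\<close> nor
  \<open>r t\<close> vanishes there.\<close>

lemma has_field_derivative_quintic_integral:
  assumes U: "open U" "0 \<notin> U" "sixth_root_on U r"
    and \<phi>: "\<phi> holomorphic_on U"
    and \<gamma>: "valid_path \<gamma>"
    and Y: "open Y" "Y \<subseteq> U"
    and D: "open D" "A0 \<in> D"
    and y: "(y has_field_derivative y') (at A0)"
    and fam: "path_family D Y b y p"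
    and I: "\<And>A. A \<in> D \<Longrightarrow> has_quintic_integral r \<phi> (\<gamma> +++ p A) (I A)"
  shows "(I has_field_derivative 5 * (\<phi> (y A0) / (y A0 * r (y A0)) * y')) (at A0)"
proof -
  define g where "g = (\<lambda>t. \<phi> t / (t * r t))"
  have g: "g holomorphic_on Y"
    unfolding g_def using U \<phi> Y sixth_root_nonzero[OF U]
    by (intro holomorphic_intros holomorphic_on_subset[OF _ Y(2)]) (auto simp: sixth_root_on_def)
  have I_eq: "I A = 5 * (contour_integral \<gamma> g + contour_integral (p A) g)" if A: "A \<in> D" for A
  proof -
    have p: "valid_path (p A)" "path_image (p A) \<subseteq> Y" using fam A by (auto simp: path_family_def)
    have 1: "g contour_integrable_on (\<gamma> +++ p A)" "I A = 5 * contour_integral (\<gamma> +++ p A) g"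
      using I[OF A] by (auto simp: has_quintic_integral_def g_def)
    \<comment> \<open>Since \<open>\<gamma>\<close> starts at the singular point, integrability
      along it is read off from that of the joined path.\<close>
    show ?thesis
      using 1 contour_integrable_joinD1[OF 1(1) \<gamma>]
        contour_integrable_holomorphic_simple[OF g Y(1) p] p(1) \<gamma> by simp
  qed
  have "((\<lambda>A. 5 * (contour_integral \<gamma> g + contour_integral (p A) g)) has_field_derivative
      5 * (g (y A0) * y')) (at A0)"
    using has_field_derivative_contour_integral_path_family[OF Y(1) g D y fam]
    by (auto intro!: derivative_eq_intros)
  then have "(I has_field_derivative 5 * (g (y A0) * y')) (at A0)"
    by (rule has_field_derivative_transform_within_open[OF _ D]) (rule I_eq[symmetric])
  then show ?thesis by (simp add: g_def)
qed

section \<open>The variable \<open>q\<close> and the power series of \<open>w\<close>\<close>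

lemma qe_nonzero [simp]: "qe z \<noteq> 0"
  by (simp add: qe_def)

lemma has_field_derivative_qe [derivative_intros]:
  "(f has_field_derivative f') (at x within S) \<Longrightarrow>
    ((\<lambda>x. qe (f x)) has_field_derivative 2 * of_real pi * \<i> * qe (f x) * f') (at x within S)"
  unfolding qe_def by (auto intro!: derivative_eq_intros)

lemma norm_qe: "norm (qe z) = exp (- (2 * pi * Im z))"
  by (simp add: qe_def)

text \<open>Needed at the cusp: the integral defining \<open>w\<close> concerns points
  \<open>qe z\<close> only, and these fill the punctured unit disc. The preimage under
  \<open>qe\<close> comes from the logarithm.\<close>

lemma qe_surj:
  assumes "q \<noteq> 0" "norm q < 1"
  obtains z where "0 < Im z" "qe z = q"
proof
  have "qe (Ln q / (2 * of_real pi * \<i>)) = exp (Ln q)"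
    unfolding qe_def by (simp add: field_simps)
  then show "qe (Ln q / (2 * of_real pi * \<i>)) = q"
    using assms by simp
  then have "exp (- (2 * pi * Im (Ln q / (2 * of_real pi * \<i>)))) < 1"
    using assms norm_qe by metis
  then show "0 < Im (Ln q / (2 * of_real pi * \<i>))"
    by (simp add: zero_less_mult_iff)
qed

text \<open>The coefficient at 0 is \<open>a 0 / 0 = 0\<close> by the convention for division, so
  the series vanishes at the origin whatever \<open>a 0\<close> is.\<close>

definition primitive_fps :: "(nat \<Rightarrow> complex) \<Rightarrow> complex fps" where
  "primitive_fps a = Abs_fps (\<lambda>n. a n / of_nat n)"

lemma conv_radius_primitive_fps: "conv_radius a \<le> fps_conv_radius (primitive_fps a)"
  unfolding fps_conv_radius_def
proof (rule conv_radius_geI_ex)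
  fix s :: real assume s: "0 < s" "ereal s < conv_radius a"
  have sm: "summable (\<lambda>n. norm (a n * of_real s ^ n))"
    by (rule abs_summable_in_conv_radius) (use s in auto)
  have le: "norm (fps_nth (primitive_fps a) n * of_real s ^ n) \<le> norm (a n * of_real s ^ n)" for n
  proof -
    have "norm (a n) / real n \<le> norm (a n)"
      using mult_left_mono[of 1 "real n" "norm (a n)"] by (cases "n = 0") (simp_all add: divide_le_eq)
    then have "norm (a n) / real n * s ^ n \<le> norm (a n) * s ^ n"
      using s(1) by (intro mult_right_mono) auto
    then show ?thesis
      using s(1) by (simp add: primitive_fps_def norm_mult norm_divide norm_power)
  qed
  from sm have "summable (\<lambda>n. fps_nth (primitive_fps a) n * of_real s ^ n)"
    by (rule summable_comparison_test'[where N = 0]) (rule le)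
  then show "\<exists>z. norm z = s \<and> summable (\<lambda>n. fps_nth (primitive_fps a) n * z ^ n)"
    using s by (intro exI[of _ "of_real s"]) auto
qed

text \<open>Differentiation cancels the denominators and the factor \<open>q\<close> restores the
  exponents. This identifies \<open>1 / P\<close> with \<open>q h'(q)\<close>.\<close>

lemma eval_deriv_primitive_fps_sums:
  assumes "ereal (norm q) < conv_radius a"
  shows "(\<lambda>n. a (Suc n) * q ^ Suc n) sums (q * eval_fps (fps_deriv (primitive_fps a)) q)"
proof -
  have "ereal (norm q) < fps_conv_radius (fps_deriv (primitive_fps a))"
    using assms conv_radius_primitive_fps[of a] fps_conv_radius_deriv[of "primitive_fps a"] by order
  from sums_mult[OF sums_eval_fps[OF this], of q] show ?thesis
    by (simp add: primitive_fps_def mult_ac del: of_nat_Suc)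
qed

text \<open>Since \<open>norm (qe t)\<close> decreases as \<open>Im t\<close> grows, the vertical
  ray from \<open>z\<close> to the cusp stays in the domain of convergence.\<close>

lemma conv_radius_uhp_mono:
  assumes "0 < Im z" "ereal (norm (qe z)) < R" "Im z \<le> Im t"
  shows "0 < Im t" "ereal (norm (qe t)) < R"
proof -
  show "0 < Im t" using assms by simp
  have "norm (qe t) \<le> norm (qe z)" using assms by (simp add: norm_qe)
  then show "ereal (norm (qe t)) < R" using assms(2)
    by (meson ereal_less_eq(3) le_less_trans)
qed

text \<open>By the chain rule \<open>h (qe t) / (2 * of_real pi * \<i>)\<close> is a primitive of
  \<open>1 / P\<close>. Each truncated integral is thus a difference of two values of
  \<open>h\<close>, and the value at the upper end tends to \<open>h 0 = 0\<close>.\<close>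

lemma cusp_integral_eq_primitive:
  assumes P: "\<And>z. 0 < Im z \<Longrightarrow> ereal (norm (qe z)) < conv_radius a \<Longrightarrow>
              (\<lambda>n. a (Suc n) * qe z ^ Suc n) sums (1 / P z)"
    and z: "0 < Im z" "ereal (norm (qe z)) < conv_radius a"
    and lim: "((\<lambda>T. 2 * of_real pi * \<i> *
         contour_integral (linepath (z + \<i> * of_real T) z) (\<lambda>t. 1 / P t)) \<longlongrightarrow> v) at_top"
  shows "v = eval_fps (primitive_fps a) (qe z)"
proof -
  define h where "h = eval_fps (primitive_fps a)"
  define S where "S = {t. Im z \<le> Im t}"
  note S = conv_radius_uhp_mono[OF z]
  have hder: "(h has_field_derivative eval_fps (fps_deriv (primitive_fps a)) q) (at q)"
    if "ereal (norm q) < conv_radius a" for q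
    unfolding h_def using has_field_derivative_eval_fps[of q "primitive_fps a" UNIV] that
      conv_radius_primitive_fps[of a] by (simp add: order_less_le_trans)
  have prim: "((\<lambda>t. h (qe t) / (2 * of_real pi * \<i>)) has_field_derivative 1 / P t) (at t within S)"
    if "t \<in> S" for t
  proof -
    have t: "0 < Im t" "ereal (norm (qe t)) < conv_radius a" using S[of t] that by (auto simp: S_def)
    have "1 / P t = qe t * eval_fps (fps_deriv (primitive_fps a)) (qe t)"
      using sums_unique2[OF P[OF t] eval_deriv_primitive_fps_sums[OF t(2)]] .
    then show ?thesis
      by (auto intro!: derivative_eq_intros DERIV_chain2[OF hder] t(2) simp: field_simps)
  qed
  have ev: "2 * of_real pi * \<i> * contour_integral (linepath (z + \<i> * of_real T) z) (\<lambda>t. 1 / P t)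
      = h (qe z) - h (qe (z + \<i> * of_real T))" if T: "0 \<le> T" for T
  proof -
    have "convex S" unfolding S_def by (rule convex_halfspace_Im_ge)
    then have "closed_segment (z + \<i> * of_real T) z \<subseteq> S"
      using T by (intro closed_segment_subset) (auto simp: S_def)
    from contour_integral_unique[OF contour_integral_primitive[OF prim, of "linepath (z + \<i> * of_real T) z"]] this
    show ?thesis by (simp add: field_simps)
  qed
  have "((\<lambda>T. norm (qe (z + \<i> * of_real T))) \<longlongrightarrow> 0) at_top"
    unfolding norm_qe
    by (rule filterlim_compose[OF exp_at_bot], rule filterlim_uminus_at_top[THEN iffD1],
        rule filterlim_tendsto_pos_mult_at_top[OF tendsto_const], simp,
        simp, rule filterlim_tendsto_add_at_top[OF tendsto_const filterlim_ident])
  then have "((\<lambda>T. qe (z + \<i> * of_real T)) \<longlongrightarrow> 0) at_top"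
    by (rule tendsto_norm_zero_cancel)
  moreover have "isCont h 0"
  proof -
    have "(0::ereal) \<le> ereal (norm (qe z))" by simp
    then have "0 < conv_radius a" using z(2) by (rule order_le_less_trans)
    then show ?thesis using DERIV_isCont[OF hder[of 0]] by (simp flip: zero_ereal_def)
  qed
  ultimately have "((\<lambda>T. h (qe (z + \<i> * of_real T))) \<longlongrightarrow> h 0) at_top"
    by (rule isCont_tendsto_compose[where g = h, rotated])
  moreover have "h 0 = 0" by (simp add: h_def eval_fps_at_0 primitive_fps_def)
  ultimately have "((\<lambda>T. h (qe z) - h (qe (z + \<i> * of_real T))) \<longlongrightarrow> h (qe z)) at_top"
    using tendsto_diff[OF tendsto_const, of "\<lambda>T. h (qe (z + \<i> * of_real T))" 0 at_top "h (qe z)"]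
    by simp
  then have "((\<lambda>T. 2 * of_real pi * \<i> *
         contour_integral (linepath (z + \<i> * of_real T) z) (\<lambda>t. 1 / P t)) \<longlongrightarrow> h (qe z)) at_top"
    by (rule Lim_transform_eventually)
       (use ev in \<open>auto intro: eventually_mono[OF eventually_ge_at_top[of 0]]\<close>)
  then show ?thesis
    using tendsto_unique[OF trivial_limit_at_top_linorder lim] by (simp add: h_def)
qed

section \<open>Construction and characterization of \<open>f\<close>\<close>

text \<open>Let \<open>\<psi>\<close> be the inverse of \<open>h\<close> and
  \<open>f = k \<circ> \<psi>\<close>. From \<open>h q = q * k q\<close> follows
  \<open>x / f x = \<psi> x\<close>, so the logarithmic derivative of \<open>f\<close> is
  \<open>1 / x\<close> minus that of \<open>\<psi>\<close>, and
  \<open>\<psi>' = 1 / h'\<close>.\<close>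

lemma quotient_inverse_function:
  fixes h k :: "complex \<Rightarrow> complex"
  assumes V: "open V" and h: "h holomorphic_on V" "inj_on h V"
    and k: "k holomorphic_on V" and hk: "\<And>q. q \<in> V \<Longrightarrow> h q = q * k q"
    and k0: "\<And>q. q \<in> V \<Longrightarrow> k q \<noteq> 0"
  obtains f where "f holomorphic_on h ` V"
    "\<And>x. x \<in> h ` V \<Longrightarrow> f x \<noteq> 0"
    "\<And>q x. q \<in> V \<Longrightarrow> x \<in> h ` V \<Longrightarrow> x / f x = q \<longleftrightarrow> x = h q"
    "\<And>q. q \<in> V \<Longrightarrow> q \<noteq> 0 \<Longrightarrow> deriv f (h q) / f (h q) = 1 / h q - 1 / (q * deriv h q)"
proof -
  obtain \<psi> where \<psi>: "\<psi> holomorphic_on h ` V" "\<And>z. z \<in> V \<Longrightarrow> deriv h z * deriv \<psi> (h z) = 1"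
    "\<And>z. z \<in> V \<Longrightarrow> \<psi> (h z) = z"
    using holomorphic_has_inverse[OF h(1) V h(2)] by metis
  have oW: "open (h ` V)" by (rule open_mapping_thm3[OF h(1) V h(2)])
  \<comment> \<open>Unlike the quotient \<open>x / \<psi> x\<close>, this form is analytic and
    nonzero also at \<open>x = 0\<close>, as the cusp requires.\<close>
  define f where "f = (\<lambda>x. k (\<psi> x))"
  have f: "f holomorphic_on h ` V"
    unfolding f_def using holomorphic_on_compose_gen[OF \<psi>(1) k] \<psi>(3) by (force simp: o_def)
  have xf: "x / f x = \<psi> x" if "x \<in> h ` V" for x
    using that \<psi>(3) hk k0 by (auto simp: f_def)
  show ?thesis
  proof
    show "f holomorphic_on h ` V" by (rule f)
    show "f x \<noteq> 0" if "x \<in> h ` V" for x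
      using that k0 \<psi>(3) by (auto simp: f_def)
    show "x / f x = q \<longleftrightarrow> x = h q" if "q \<in> V" "x \<in> h ` V" for q x
      using xf[OF that(2)] that \<psi>(3) by auto
    show "deriv f (h q) / f (h q) = 1 / h q - 1 / (q * deriv h q)" if q: "q \<in> V" "q \<noteq> 0" for q
    proof -
      have hq: "h q \<in> h ` V" using q by simp
      have fd: "(f has_field_derivative deriv f (h q)) (at (h q))"
        using holomorphic_derivI[OF f oW hq] .
      have "(\<psi> has_field_derivative deriv \<psi> (h q)) (at (h q))"
        using holomorphic_derivI[OF \<psi>(1) oW hq] .
      then have "((\<lambda>x. f x * \<psi> x) has_field_derivative
          deriv f (h q) * \<psi> (h q) + deriv \<psi> (h q) * f (h q)) (at (h q))"
        by (intro DERIV_mult fd)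
      then have "((\<lambda>x. x) has_field_derivative
          deriv f (h q) * \<psi> (h q) + deriv \<psi> (h q) * f (h q)) (at (h q))"
        by (rule has_field_derivative_transform_within_open[OF _ oW hq])
           (use \<psi>(3) hk in \<open>auto simp: f_def\<close>)
      from DERIV_unique[OF this DERIV_ident]
      have e: "deriv f (h q) * q + deriv \<psi> (h q) * k q = 1" using \<psi>(3)[OF q(1)] by (simp add: f_def)
      have d: "deriv h q \<noteq> 0" "deriv \<psi> (h q) = 1 / deriv h q"
        using \<psi>(2)[OF q(1)] by (auto simp: divide_inverse dest: inverse_unique)
      have fq: "f (h q) = k q" using \<psi>(3)[OF q(1)] by (simp add: f_def)
      have "deriv f (h q) * q = 1 - k q / deriv h q"
        using e unfolding d(2) by (simp add: algebra_simps)
      then have df: "deriv f (h q) = (1 - k q / deriv h q) / q"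
        using q(2) by (simp add: eq_divide_eq)
      have "deriv f (h q) / f (h q) = (1 - k q / deriv h q) / q / k q"
        by (simp only: df fq)
      also have "\<dots> = 1 / (q * k q) - 1 / (q * deriv h q)"
        using d(1) q(2) k0[OF q(1)] by (simp add: field_simps)
      also have "q * k q = h q" using hk[OF q(1)] by simp
      finally show ?thesis .
    qed
  qed
qed

text \<open>Applied to \<open>u A = w (qe A)\<close>. The equation says that
  \<open>u A / f (u A)\<close> has logarithmic derivative \<open>2 * of_real pi * \<i>\<close>, the
  same as \<open>qe\<close>. Their quotient is therefore constant on the connected set
  \<open>D\<close>, and this is the constant of integration.\<close>

lemma log_derivative_solution:
  fixes u f :: "complex \<Rightarrow> complex"
  assumes D: "open D" "connected D" and u: "u holomorphic_on D" "0 \<notin> u ` D"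
    and du: "\<And>A. A \<in> D \<Longrightarrow> deriv u A \<noteq> 0"
    and f: "f holomorphic_on u ` D" "\<And>A. A \<in> D \<Longrightarrow> f (u A) \<noteq> 0"
    and eq: "\<And>A. A \<in> D \<Longrightarrow>
      deriv f (u A) / f (u A) = 1 / u A - 2 * of_real pi * \<i> / deriv u A"
  shows "\<exists>C. C \<noteq> 0 \<and> (\<forall>A\<in>D. u A / (C * f (u A)) = qe A)"
proof (cases "D = {}")
  case True
  then show ?thesis by (intro exI[of _ 1]) auto
next
  case False
  then obtain B where B: "B \<in> D" by auto
  have ud: "(u has_field_derivative deriv u A) (at A)" if "A \<in> D" for A
    using holomorphic_derivI[OF u(1) D(1) that] .
  \<comment> \<open>By the open mapping theorem the image of \<open>D\<close> is then open, so that
    \<open>deriv f (u A)\<close> is a true derivative of \<open>f\<close>, which is holomorphic on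
    this image.\<close>
  have "\<not> u constant_on D"
  proof
    assume "u constant_on D"
    then obtain K where "\<And>A. A \<in> D \<Longrightarrow> u A = K" by (auto simp: constant_on_def)
    then have "(u has_field_derivative 0) (at B)"
      by (intro has_field_derivative_transform_within_open[OF DERIV_const D(1) B]) auto
    with ud[OF B] du[OF B] show False using DERIV_unique by blast
  qed
  then have oW: "open (u ` D)"
    using open_mapping_thm[OF u(1) D(1,2) D(1)] by simp
  define v where "v A = u A / (f (u A) * qe A)" for A
  have "(v has_field_derivative 0) (at A)" if A: "A \<in> D" for A
  proof -
    have fd: "(f has_field_derivative deriv f (u A)) (at (u A))"
      by (rule holomorphic_derivI[OF f(1) oW]) (use A in auto)
    have u0: "u A \<noteq> 0" using u(2) A by (metis imageI)
    \<comment> \<open>The equation cleared of denominators; it makes the numerator in the quotient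
      rule for \<open>v\<close> vanish.\<close>
    have "deriv f (u A) * deriv u A * u A = f (u A) * (deriv u A - 2 * of_real pi * \<i> * u A)"
      using eq[OF A] u0 du[OF A] f(2)[OF A] by (simp add: field_simps)
    then have "deriv u A * (f (u A) * qe A) =
        u A * (deriv f (u A) * deriv u A * qe A + 2 * of_real pi * \<i> * qe A * f (u A))"
      by algebra
    moreover have fu: "((\<lambda>A. f (u A)) has_field_derivative deriv f (u A) * deriv u A) (at A)"
      by (rule DERIV_chain2[where f = f and g = u, OF fd ud[OF A]])
    have "((\<lambda>A. f (u A) * qe A) has_field_derivative
        deriv f (u A) * deriv u A * qe A + 2 * of_real pi * \<i> * qe A * f (u A)) (at A)"
      using DERIV_mult[OF fu has_field_derivative_qe[OF DERIV_ident]] by simp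
    from DERIV_divide[OF ud[OF A] this] have "(v has_field_derivative
        (deriv u A * (f (u A) * qe A) -
         u A * (deriv f (u A) * deriv u A * qe A + 2 * of_real pi * \<i> * qe A * f (u A))) /
        (f (u A) * qe A * (f (u A) * qe A))) (at A)"
      using f(2)[OF A] by (simp add: v_def [abs_def])
    ultimately show ?thesis by simp
  qed
  then have "v constant_on D"
    by (rule has_field_derivative_0_imp_constant_on) (use D in auto)
  then obtain C where C: "\<And>A. A \<in> D \<Longrightarrow> v A = C" by (auto simp: constant_on_def)
  have nz: "u A \<noteq> 0" if "A \<in> D" for A using u(2) that by (metis imageI)
  have C0: "C \<noteq> 0" using C[OF B] nz[OF B] f(2)[OF B] by (auto simp: v_def)
  have "u A / (C * f (u A)) = qe A" if "A \<in> D" for A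
  proof -
    have "u A = C * (f (u A) * qe A)"
      using C[OF that] f(2)[OF that] by (auto simp: v_def divide_eq_eq)
    then show ?thesis
      using C0 f(2)[OF that] by (simp add: divide_eq_eq mult_ac)
  qed
  with C0 show ?thesis by blast
qed

text \<open>The limit in \<open>w\<close> prescribes values at points \<open>qe z\<close>, which are
  nonzero, so \<open>w0\<close> adds the value at the cusp. There the equation for \<open>f\<close>
  is asked only at points \<open>w (qe A)\<close> with \<open>A\<close> in \<open>D\<close>, because
  \<open>F\<^sub>1\<close> is pinned down only at values of the integral.\<close>

theorem theorem5:
  fixes a :: "nat \<Rightarrow> complex" and P w y G F\<^sub>1 r :: "complex \<Rightarrow> complex" and c :: complex
    and D U Y :: "complex set" and \<gamma> :: "real \<Rightarrow> complex" and p :: "complex \<Rightarrow> real \<Rightarrow> complex"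
  assumes radius: "0 < conv_radius a"
    and P: "\<And>z. 0 < Im z \<Longrightarrow> ereal (norm (qe z)) < conv_radius a \<Longrightarrow>
              (\<lambda>n. a (Suc n) * qe z ^ Suc n) sums (1 / P z)"
    and a1: "a 1 \<noteq> 0"
    and w: "\<And>z. 0 < Im z \<Longrightarrow> ereal (norm (qe z)) < conv_radius a \<Longrightarrow>
              ((\<lambda>T. 2 * of_real pi * \<i> *
                   contour_integral (linepath (z + \<i> * of_real T) z) (\<lambda>t. 1 / P t)) \<longlongrightarrow> w (qe z)) at_top"
    and w0: "w 0 = 0"
    and D: "open D" "connected D" "\<And>A. A \<in> D \<Longrightarrow> 0 < Im A \<and> ereal (norm (qe A)) < conv_radius a"
    and U: "open U" "0 \<notin> U"
    and root: "sixth_root_on U r"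
    and path0: "initial_path U \<gamma>"
    and Y: "open Y" "Y \<subseteq> U" "pathfinish \<gamma> \<in> Y"
    and F1: "inverse_branch r \<gamma> Y F\<^sub>1"
    and G: "G holomorphic_on U"
    and y: "y holomorphic_on D"
    and paths: "path_family D Y (pathfinish \<gamma>) y p"
    and int_G: "\<And>A. A \<in> D \<Longrightarrow> has_quintic_integral r G (\<gamma> +++ p A) A"
    and int_1: "\<And>A. A \<in> D \<Longrightarrow>
       has_quintic_integral r (\<lambda>t. 1) (\<gamma> +++ p A) ((c - w (qe A)) / (2 * of_real pi * \<i>))"
  shows
    \<comment> \<open>every solution of the equation for f, suitably scaled, satisfies w / f(w) = q\<close>
    "(\<forall>D' f. open D' \<and> connected D' \<and> D' \<subseteq> D \<and> 0 \<notin> (w \<circ> qe) ` D' \<and>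
        f holomorphic_on (w \<circ> qe) ` D' \<and>
        (\<forall>x\<in>(w \<circ> qe) ` D'. f x \<noteq> 0 \<and> f_equation G F\<^sub>1 c f x) \<longrightarrow>
        (\<exists>C. C \<noteq> 0 \<and> (\<forall>A\<in>D'. w (qe A) / (C * f (w (qe A))) = qe A)))
     \<and> \<comment> \<open>near each point of D such an f exists and w(q) is the only solution\<close>
     (\<forall>A\<^sub>0\<in>D. w (qe A\<^sub>0) \<noteq> 0 \<longrightarrow>
        (\<exists>D' W f. open D' \<and> connected D' \<and> A\<^sub>0 \<in> D' \<and> D' \<subseteq> D \<and>
           W = (w \<circ> qe) ` D' \<and> open W \<and> 0 \<notin> W \<and> f holomorphic_on W \<and>
           (\<forall>x\<in>W. f x \<noteq> 0 \<and> f_equation G F\<^sub>1 c f x) \<and>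
           (\<forall>A\<in>D'. \<forall>x\<in>W. x / f x = qe A \<longleftrightarrow> x = w (qe A))))
     \<and> \<comment> \<open>the same at q = 0, where f extends analytically\<close>
     (\<exists>\<rho> W f. 0 < \<rho> \<and> ereal \<rho> \<le> conv_radius a \<and> W = w ` ball 0 \<rho> \<and> open W \<and> f holomorphic_on W \<and>
        (\<forall>x\<in>W. f x \<noteq> 0) \<and>
        (\<forall>q\<in>ball 0 \<rho>. \<forall>x\<in>W. x / f x = q \<longleftrightarrow> x = w q) \<and>
        (\<forall>A\<in>D. qe A \<in> ball 0 \<rho> \<longrightarrow> f_equation G F\<^sub>1 c f (w (qe A))))
     \<and> (\<forall>A\<in>D. y A = F\<^sub>1 (- (w (qe A) / (2 * of_real pi * \<i>)) + c / (2 * of_real pi * \<i>)))"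
proof -
  let ?arg = "\<lambda>x. - (x / (2 * of_real pi * \<i>)) + c / (2 * of_real pi * \<i>)"

  \<comment> \<open>The series \<open>h\<close> and its cofactor \<open>k\<close>\<close>
  define h where "h = eval_fps (primitive_fps a)"
  \<comment> \<open>This is \<open>h q / q\<close> with the singularity at 0 removed.\<close>
  define k where "k = eval_fps (fps_shift 1 (primitive_fps a))"
  define B where "B = eball (0::complex) (conv_radius a)"
  have B: "open B" "0 \<in> B" "\<And>q. q \<in> B \<longleftrightarrow> ereal (norm q) < conv_radius a"
    using radius by (auto simp: B_def in_eball_iff simp flip: zero_ereal_def)
  have BR: "B \<subseteq> eball 0 (fps_conv_radius (primitive_fps a))"
    unfolding B_def using conv_radius_primitive_fps[of a] by (rule eball_mono)
  have hB: "h holomorphic_on B"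
    unfolding h_def using BR by (intro holomorphic_on_eval_fps)
  have kB: "k holomorphic_on B"
    unfolding k_def using BR by (intro holomorphic_on_eval_fps) simp
  have primitive_0: "fps_nth (primitive_fps a) 0 = 0"
    by (simp add: primitive_fps_def)
  have k_at_0: "k 0 = a 1"
    by (simp add: k_def eval_fps_at_0 primitive_fps_def)
  have deriv_h: "deriv h q = eval_fps (fps_deriv (primitive_fps a)) q" if "q \<in> B" for q
    unfolding h_def using that BR by (intro DERIV_imp_deriv has_field_derivative_eval_fps) (auto simp: in_eball_iff)
  have hk: "h q = q * k q" if "q \<in> B" for q
  \<comment> \<open>Splitting off \<open>q\<close> by a shift needs \<open>subdegree\<close> at
    least 1, while the zero series has \<open>subdegree\<close> 0.\<close>
  proof (cases "primitive_fps a = 0")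
    case True
    then show ?thesis by (simp add: h_def k_def)
  next
    case False
    then have "1 \<le> subdegree (primitive_fps a)"
      using primitive_0 by (intro subdegree_geI) auto
    then show ?thesis
      using eval_fps_shift[of 1 "primitive_fps a" q] that BR primitive_0
      by (auto simp: h_def k_def in_eball_iff eval_fps_at_0)
  qed
  have h0: "h 0 = 0" using hk[OF B(2)] by simp
  have deriv_h0: "deriv h 0 = a 1"
    using deriv_h[OF B(2)] by (simp add: eval_fps_at_0 primitive_fps_def)
  have wh: "w (qe z) = h (qe z)" if "0 < Im z" "qe z \<in> B" for z
    unfolding h_def using cusp_integral_eq_primitive[OF P that(1)] that w[OF that(1)] B(3) by auto
  have D': "0 < Im A" "qe A \<in> B" if "A \<in> D" for A
    using D(3)[OF that] B(3) by auto
  have whD: "w (qe A) = h (qe A)" if "A \<in> D" for A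
    using wh D'[OF that] by simp
  have dh: "((\<lambda>A. h (qe A)) has_field_derivative 2 * of_real pi * \<i> * (qe A * deriv h (qe A))) (at A)"
    if A: "qe A \<in> B" for A
    using DERIV_chain2[where f = h and g = qe, OF holomorphic_derivI[OF hB B(1) A]
        has_field_derivative_qe[OF DERIV_ident]] by (simp add: mult_ac)

  \<comment> \<open>The values of \<open>y\<close> and of \<open>G\<close> along
    \<open>y\<close>\<close>
  have fam: "valid_path (p A)" "path_image (p A) \<subseteq> Y" "pathstart (p A) = pathfinish \<gamma>"
    "pathfinish (p A) = y A" if "A \<in> D" for A
    using paths that by (auto simp: path_family_def)
  have yF: "y A = F\<^sub>1 (?arg (w (qe A)))" if A: "A \<in> D" for A
  proof -
    have "y A \<in> Y" using fam(2,4)[OF A] by (metis pathfinish_in_path_image subsetD)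
    then have "F\<^sub>1 ((c - w (qe A)) / (2 * of_real pi * \<i>)) = y A"
      using F1 fam[OF A] int_1[OF A] unfolding inverse_branch_def by blast
    then show ?thesis by (simp add: diff_divide_distrib)
  qed
  have Gy: "deriv h (qe A) \<noteq> 0" "G (F\<^sub>1 (?arg (w (qe A)))) = - 1 / (qe A * deriv h (qe A))"
    if A: "A \<in> D" for A
  proof -
    \<comment> \<open>The factor shared by both differentiated equations: the first gives
      \<open>G (y A) * \<delta> = 1\<close>, the second \<open>\<delta> = - q h'(q)\<close>. The
      former makes \<open>\<delta>\<close> nonzero, hence also \<open>h'(q)\<close>.\<close>
    define \<delta> where "\<delta> = 5 * (1 / (y A * r (y A)) * deriv y A)"
    have dy: "(y has_field_derivative deriv y A) (at A)"
      by (rule holomorphic_derivI[OF y D(1) A])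
    have \<gamma>: "valid_path \<gamma>" using path0 by (simp add: initial_path_def)
    have "((\<lambda>A. A) has_field_derivative 5 * (G (y A) / (y A * r (y A)) * deriv y A)) (at A)"
      by (rule has_field_derivative_quintic_integral
          [OF U root G \<gamma> Y(1,2) D(1) A dy paths int_G])
    from DERIV_unique[OF this DERIV_ident] have 1: "G (y A) * \<delta> = 1"
      by (simp add: \<delta>_def divide_inverse mult_ac)
    have 2: "((\<lambda>A. (c - w (qe A)) / (2 * of_real pi * \<i>)) has_field_derivative \<delta>) (at A)"
      unfolding \<delta>_def
      by (rule has_field_derivative_quintic_integral
          [OF U root holomorphic_on_const \<gamma> Y(1,2) D(1) A dy paths int_1])
    have "((\<lambda>A. (c - h (qe A)) / (2 * of_real pi * \<i>)) has_field_derivative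
        - (qe A * deriv h (qe A))) (at A)"
      using DERIV_cdivide[OF DERIV_diff[OF DERIV_const dh[OF D'(2)[OF A]]],
          of c "2 * of_real pi * \<i>"] by simp
    then have "((\<lambda>A. (c - w (qe A)) / (2 * of_real pi * \<i>)) has_field_derivative
        - (qe A * deriv h (qe A))) (at A)"
      by (rule has_field_derivative_transform_within_open[OF _ D(1) A]) (simp add: whD)
    from DERIV_unique[OF 2 this] have 3: "\<delta> = - (qe A * deriv h (qe A))" .
    show "deriv h (qe A) \<noteq> 0" using 1 3 by auto
    moreover have "G (y A) * (qe A * deriv h (qe A)) = - 1" using 1 3 by algebra
    ultimately show "G (F\<^sub>1 (?arg (w (qe A)))) = - 1 / (qe A * deriv h (qe A))"
      unfolding yF[OF A, symmetric] by (subst nonzero_eq_divide_eq) simp_all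
  qed
  have f_eq: "f_equation G F\<^sub>1 c f (w (qe A)) \<longleftrightarrow>
      deriv f (h (qe A)) / f (h (qe A)) = 1 / h (qe A) - 1 / (qe A * deriv h (qe A))"
    if "A \<in> D" for f A
    unfolding f_equation_def Gy(2)[OF that] by (simp add: whD[OF that])

  \<comment> \<open>Arbitrary solutions of the equation for \<open>f\<close>\<close>
  have scaled: "\<exists>C. C \<noteq> 0 \<and> (\<forall>A\<in>D'. w (qe A) / (C * f (w (qe A))) = qe A)"
    if D'': "open D'" "connected D'" "D' \<subseteq> D" "0 \<notin> (w \<circ> qe) ` D'"
      and f: "f holomorphic_on (w \<circ> qe) ` D'"
        "\<forall>x\<in>(w \<circ> qe) ` D'. f x \<noteq> 0 \<and> f_equation G F\<^sub>1 c f x" for D' f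
  proof -
    have du: "((\<lambda>A. w (qe A)) has_field_derivative 2 * of_real pi * \<i> * (qe A * deriv h (qe A))) (at A)"
      if A: "A \<in> D'" for A
    proof -
      have "((\<lambda>A. h (qe A)) has_field_derivative 2 * of_real pi * \<i> * (qe A * deriv h (qe A))) (at A)"
        using A D''(3) D'(2) by (intro dh) auto
      then show ?thesis
        by (rule has_field_derivative_transform_within_open[OF _ D''(1) A])
           (use D''(3) whD in auto)
    qed
    \<comment> \<open>The chain rule factor \<open>2 * of_real pi * \<i> * q\<close> of
      \<open>w \<circ> qe\<close> turns \<open>1 / (q h'(q))\<close> into the last term.\<close>
    have eq: "deriv f (w (qe A)) / f (w (qe A)) =
        1 / w (qe A) - 2 * of_real pi * \<i> / deriv (\<lambda>A. w (qe A)) A" if A: "A \<in> D'" for A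
    proof -
      have AD: "A \<in> D" using A D''(3) by auto
      have "f_equation G F\<^sub>1 c f (w (qe A))" using f(2) A by auto
      then show ?thesis using f_eq[OF AD] DERIV_imp_deriv[OF du[OF A]] whD[OF AD] by simp
    qed
    show ?thesis
    proof (rule log_derivative_solution[OF D''(1,2)])
      show "(\<lambda>A. w (qe A)) holomorphic_on D'"
        using du D''(1) by (auto simp: holomorphic_on_open)
      show "deriv (\<lambda>A. w (qe A)) A \<noteq> 0" if "A \<in> D'" for A
        using DERIV_imp_deriv[OF du[OF that]] Gy(1) D''(3) that by auto
    qed (use D'' f eq in \<open>auto simp: o_def\<close>)
  qed

  \<comment> \<open>Existence near a point of \<open>D\<close>\<close>
  have local_sol: "\<exists>D' W f. open D' \<and> connected D' \<and> A\<^sub>0 \<in> D' \<and> D' \<subseteq> D \<and>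
           W = (w \<circ> qe) ` D' \<and> open W \<and> 0 \<notin> W \<and> f holomorphic_on W \<and>
           (\<forall>x\<in>W. f x \<noteq> 0 \<and> f_equation G F\<^sub>1 c f x) \<and>
           (\<forall>A\<in>D'. \<forall>x\<in>W. x / f x = qe A \<longleftrightarrow> x = w (qe A))"
    if A0: "A\<^sub>0 \<in> D" "w (qe A\<^sub>0) \<noteq> 0" for A\<^sub>0
  proof -
    \<comment> \<open>Leaving out the zeros of \<open>h\<close> keeps 0 out of \<open>W\<close> and,
      by \<open>h q = q * k q\<close>, makes \<open>k\<close> nonzero.\<close>
    define B' where "B' = {q \<in> B. h q \<noteq> 0}"
    have "B' = B \<inter> h -` (- {0})" by (auto simp: B'_def)
    then have oB': "open B'"
      using continuous_open_preimage[OF holomorphic_on_imp_continuous_on[OF hB] B(1)] by auto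
    have "qe A\<^sub>0 \<in> B'" using A0 whD D' by (auto simp: B'_def)
    moreover have "B' \<subseteq> B" by (auto simp: B'_def)
    ultimately obtain s where s: "0 < s" "ball (qe A\<^sub>0) s \<subseteq> B'" "inj_on h (ball (qe A\<^sub>0) s)"
      using has_complex_derivative_locally_injective[OF holomorphic_on_subset[OF hB] _ oB' Gy(1)[OF A0(1)]]
      by metis
    have "isCont qe A\<^sub>0"
      using DERIV_isCont[OF has_field_derivative_qe[OF DERIV_ident]] .
    then have "\<forall>\<^sub>F A in nhds A\<^sub>0. qe A \<in> ball (qe A\<^sub>0) s"
      using s(1) by (intro topological_tendstoD) (auto simp: isCont_def tendsto_at_iff_tendsto_nhds)
    moreover have "\<forall>\<^sub>F A in nhds A\<^sub>0. A \<in> D"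
      using D(1) A0(1) by (rule eventually_nhds_in_open)
    ultimately have "\<forall>\<^sub>F A in nhds A\<^sub>0. qe A \<in> ball (qe A\<^sub>0) s \<and> A \<in> D"
      by (rule eventually_conj)
    then obtain e where e: "0 < e" "\<And>A. A \<in> ball A\<^sub>0 e \<Longrightarrow> qe A \<in> ball (qe A\<^sub>0) s \<and> A \<in> D"
      unfolding eventually_nhds_metric by (auto simp: dist_commute)
    have sB: "ball (qe A\<^sub>0) s \<subseteq> B" using s(2) by (auto simp: B'_def)
    \<comment> \<open>Taking the image of a disc in \<open>A\<close>, not a disc in
      \<open>q\<close>, ensures that every point of \<open>W\<close> is \<open>w (qe A)\<close> with
      \<open>A\<close> in \<open>D\<close>, where \<open>f_eq\<close> applies.\<close>
    define V where "V = qe ` ball A\<^sub>0 e"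
    have V: "V \<subseteq> ball (qe A\<^sub>0) s" using e by (auto simp: V_def)
    have oV: "open V" unfolding V_def
    proof (rule open_mapping_thm[where S = UNIV])
      show "qe holomorphic_on UNIV"
        unfolding qe_def by (intro holomorphic_intros)
      show "\<not> qe constant_on UNIV"
      proof
        assume "qe constant_on UNIV"
        \<comment> \<open>These values are -1 and 1.\<close>
        then have "qe (1/2) = qe 0" by (metis UNIV_I constant_on_def)
        then show False by (simp add: qe_def exp_pi_i' mult.commute)
      qed
    qed auto
    have VB: "V \<subseteq> B'" "V \<subseteq> B" using V s(2) by (auto simp: B'_def)
    have inj: "inj_on h V" using s(3) V by (rule inj_on_subset)
    have hkV: "h q = q * k q" if "q \<in> V" for q using hk VB that by auto
    have kV0: "k q \<noteq> 0" if "q \<in> V" for q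
      using hk[of q] VB that by (auto simp: B'_def)
    from quotient_inverse_function[OF oV holomorphic_on_subset[OF hB VB(2)] inj
        holomorphic_on_subset[OF kB VB(2)] hkV kV0]
    obtain f where f: "f holomorphic_on h ` V" "\<And>x. x \<in> h ` V \<Longrightarrow> f x \<noteq> 0"
      "\<And>q x. q \<in> V \<Longrightarrow> x \<in> h ` V \<Longrightarrow> x / f x = q \<longleftrightarrow> x = h q"
      "\<And>q. q \<in> V \<Longrightarrow> q \<noteq> 0 \<Longrightarrow> deriv f (h q) / f (h q) = 1 / h q - 1 / (q * deriv h q)"
      by blast
    have W: "h ` V = (w \<circ> qe) ` ball A\<^sub>0 e"
      unfolding V_def image_image using e whD by (intro image_cong) auto
    have inV: "qe A \<in> V" if "A \<in> ball A\<^sub>0 e" for A using that by (auto simp: V_def)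
    show ?thesis
    proof (rule exI[of _ "ball A\<^sub>0 e"], rule exI[of _ "h ` V"], rule exI[of _ f], intro conjI ballI)
      show "open (h ` V)"
        by (rule open_mapping_thm3[OF holomorphic_on_subset[OF hB VB(2)] oV inj])
      show "0 \<notin> h ` V" using VB by (auto simp: B'_def)
      fix x assume x: "x \<in> h ` V"
      then obtain A where A: "A \<in> ball A\<^sub>0 e" "x = w (qe A)" using W by auto
      have AD: "A \<in> D" using e A by auto
      show "f_equation G F\<^sub>1 c f x"
        using f_eq[OF AD, of f] f(4)[OF inV[OF A(1)]] by (simp add: A(2))
    next
      fix A x assume "A \<in> ball A\<^sub>0 e" "x \<in> h ` V"
      then show "(x / f x = qe A) = (x = w (qe A))"
        using f(3)[OF inV] whD e by auto
    qed (use e W f in auto)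
  qed

  \<comment> \<open>Existence at the cusp\<close>
  have cusp: "\<exists>\<rho> W f. 0 < \<rho> \<and> ereal \<rho> \<le> conv_radius a \<and> W = w ` ball 0 \<rho> \<and> open W \<and> f holomorphic_on W \<and>
        (\<forall>x\<in>W. f x \<noteq> 0) \<and>
        (\<forall>q\<in>ball 0 \<rho>. \<forall>x\<in>W. x / f x = q \<longleftrightarrow> x = w q) \<and>
        (\<forall>A\<in>D. qe A \<in> ball 0 \<rho> \<longrightarrow> f_equation G F\<^sub>1 c f (w (qe A)))"
  proof -
    \<comment> \<open>Inside the unit disc every nonzero \<open>q\<close> is some
      \<open>qe z\<close> with \<open>0 < Im z\<close>, so \<open>w\<close> and \<open>h\<close> can
      be identified.\<close>
    define B' where "B' = B \<inter> ball 0 1"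
    have oB': "open B'" "0 \<in> B'" "B' \<subseteq> B" using B(1,2) by (auto simp: B'_def)
    have "deriv h 0 \<noteq> 0" using deriv_h0 a1 by simp
    then obtain \<rho> where \<rho>: "0 < \<rho>" "ball 0 \<rho> \<subseteq> B'" "inj_on h (ball 0 \<rho>)"
      using has_complex_derivative_locally_injective[OF holomorphic_on_subset[OF hB oB'(3)] oB'(2,1)]
      by metis
    have \<rho>B: "ball 0 \<rho> \<subseteq> B" using \<rho>(2) by (auto simp: B'_def)
    have wh': "w q = h q" if q: "q \<in> ball 0 \<rho>" for q
    proof (cases "q = 0")
      case False
      moreover have "norm q < 1" using \<rho>(2) q by (auto simp: B'_def)
      ultimately obtain z where "0 < Im z" "qe z = q" by (rule qe_surj)
      then show ?thesis using wh \<rho>B q by auto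
    qed (simp add: h0 w0)
    \<comment> \<open>A zero of \<open>k\<close> is a zero of \<open>h\<close>, so injectivity
      forces \<open>q = 0\<close>; but \<open>k 0 = a 1\<close>.\<close>
    have k0: "k q \<noteq> 0" if q: "q \<in> ball 0 \<rho>" for q
    proof
      assume "k q = 0"
      then have "h q = h 0" using hk[of q] h0 q \<rho>B by auto
      then have "q = 0" using \<rho> q by (auto dest: inj_onD)
      then show False using \<open>k q = 0\<close> k_at_0 a1 by simp
    qed
    have hk': "h q = q * k q" if "q \<in> ball 0 \<rho>" for q using hk \<rho>B that by auto
    from quotient_inverse_function[OF open_ball holomorphic_on_subset[OF hB \<rho>B] \<rho>(3)
        holomorphic_on_subset[OF kB \<rho>B] hk' k0]
    obtain f where f: "f holomorphic_on h ` ball 0 \<rho>" "\<And>x. x \<in> h ` ball 0 \<rho> \<Longrightarrow> f x \<noteq> 0"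
      "\<And>q x. q \<in> ball 0 \<rho> \<Longrightarrow> x \<in> h ` ball 0 \<rho> \<Longrightarrow> x / f x = q \<longleftrightarrow> x = h q"
      "\<And>q. q \<in> ball 0 \<rho> \<Longrightarrow> q \<noteq> 0 \<Longrightarrow> deriv f (h q) / f (h q) = 1 / h q - 1 / (q * deriv h q)"
      by blast
    have W: "w ` ball 0 \<rho> = h ` ball 0 \<rho>" using wh' by (intro image_cong) auto
    have \<rho>R: "ereal \<rho> \<le> conv_radius a"
    proof (rule ccontr)
      assume "\<not> ereal \<rho> \<le> conv_radius a"
      \<comment> \<open>Otherwise the point \<open>q = R\<close> on the circle of convergence would
        lie in the disc, hence in the open set \<open>B\<close>.\<close>
      then have lt: "conv_radius a < ereal \<rho>" by simp
      then obtain R where R: "conv_radius a = ereal R" "0 < R" "R < \<rho>"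
        using radius by (cases "conv_radius a") auto
      then have "of_real R \<in> ball (0::complex) \<rho>" by simp
      then have "of_real R \<in> B" using \<rho>B by auto
      with R B(3)[of "of_real R"] show False by simp
    qed
    show ?thesis
    proof (intro exI[of _ \<rho>] exI[of _ "w ` ball 0 \<rho>"] exI[of _ f] conjI ballI impI)
      show "open (w ` ball 0 \<rho>)"
        unfolding W by (rule open_mapping_thm3[OF holomorphic_on_subset[OF hB \<rho>B] open_ball \<rho>(3)])
      show "f_equation G F\<^sub>1 c f (w (qe A))" if "A \<in> D" "qe A \<in> ball 0 \<rho>" for A
        using f_eq[OF that(1)] f(4)[OF that(2)] by simp
      show "(x / f x = q) = (x = w q)" if "q \<in> ball 0 \<rho>" "x \<in> w ` ball 0 \<rho>" for q x
        using f(3)[OF that(1)] that wh' by (simp add: W)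
    qed (use \<rho> \<rho>R f W in auto)
  qed
  show ?thesis
    by (intro conjI allI impI ballI; (elim conjE)?;
        (rule scaled | rule local_sol | rule cusp | rule yF); assumption?)
qed

end
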